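(* Let $X$ be a first countable, Hausdorff topological vector space over $\mathbb{K}$ ($=\mathbb{R}$ or $\mathbb{C}$), let $\mu$ be a non-zero measure on the Borel $\sigma$-algebra of $X$ that is finite on bounded sets, and let $K\subset X$ be a bounded, open neighbourhood of the origin. Let $E\subset X$ be a nonempty subset. If the pair $(u,E)$, with $u\in X$, satisfies the uniformity condition: there exists $(v^{\ast},r^{\ast})\in E\times(0,1)$ such that, for all $r\in(0,r^{\ast})$, $$f(u-v^{\ast},r)=\sup_{z\in u-E} f(z,r),$$ then $u$ is an $E$-weak mode of $\mu$ if and only if $u$ is an $E$-strong mode of $\mu$.
   Context: For $x\in X$ and real $r>0$, put $K(x,r)=x+rK$ and $f(x,r)=\mu(K(x,r))$, which is finite and nonnegative. For $E\subset X$, $u-E=\{u-v : v\in E\}$. $\operatorname{supp}(\mu)$ is the topological support of $\mu$, i.e. the set of points all of whose open neighbourhoods have positive $\mu$-measure. An $E$-weak mode of $\mu$ is any $u\in\operatorname{supp}(\mu)$ such that $\lim_{r\downarrow 0}\frac{f(u-v,r)}{f(u,r)}\le 1$ for every $v\in E$. An $E$-strong mode of $\mu$ is any $u\in\operatorname{supp}(\mu)$ such that $\lim_{r\downarrow 0}\frac{\sup_{z\in u-E} f(z,r)}{f(u,r)}\le 1$.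
   Formalization: In the definitions of E-weak and E-strong mode, the limit as r decreases to 0 is replaced by the upper limit, since the limit for an individual v may fail to exist even when the limit for the supremum exists; the two readings agree whenever the limits exist. *)

theory Defs
  imports "HOL-Analysis.Analysis"
begin

text \<open>
  The scalars are an arbitrary \<^class>\<open>real_normed_field\<close>. By the Gelfand-Mazur theorem the only such
  fields, up to isometric isomorphism, are the real and the complex numbers.
\<close>

locale topological_vector_space = vector_space smul
  for smul :: "'k::real_normed_field \<Rightarrow> 'a::topological_ab_group_add \<Rightarrow> 'a" +
  assumes continuous_smul: "continuous_on UNIV (\<lambda>(c, x). smul c x)"

text \<open>Von Neumann boundedness: every neighbourhood of the origin absorbs \<open>B\<close>.\<close>

definition tvs_bounded :: "('k::real_normed_field \<Rightarrow> 'a::topological_ab_group_add \<Rightarrow> 'a) \<Rightarrow> 'a set \<Rightarrow> bool"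
  where "tvs_bounded smul B \<longleftrightarrow>
    (\<forall>V. open V \<and> 0 \<in> V \<longrightarrow> (\<exists>s>0. \<forall>t. s \<le> norm t \<longrightarrow> B \<subseteq> smul t ` V))"

definition msupp :: "'a::topological_space measure \<Rightarrow> 'a set"
  where "msupp \<mu> = {x. \<forall>U. open U \<and> x \<in> U \<longrightarrow> 0 < emeasure \<mu> U}"

definition Kset :: "('k::real_normed_field \<Rightarrow> 'a::topological_ab_group_add \<Rightarrow> 'a) \<Rightarrow> 'a set \<Rightarrow> 'a \<Rightarrow> real \<Rightarrow> 'a set"
  where "Kset smul K x r = {x + smul (of_real r) k |k. k \<in> K}"

text \<open>
  The mass of a translated and scaled copy of \<open>K\<close> is finite for each fixed centre, but its supremum
  over the centres in \<open>u - E\<close> may be infinite when \<open>E\<close> is unbounded. Hence masses, suprema and ratios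
  are taken in \<^typ>\<open>ennreal\<close>. In the ratios below the denominator is positive for \<open>u\<close> in the support.
\<close>

definition Kmass :: "('k::real_normed_field \<Rightarrow> 'a::topological_ab_group_add \<Rightarrow> 'a) \<Rightarrow> 'a set \<Rightarrow>
    'a measure \<Rightarrow> 'a \<Rightarrow> real \<Rightarrow> ennreal"
  where "Kmass smul K \<mu> x r = emeasure \<mu> (Kset smul K x r)"

definition reflect :: "'a::minus \<Rightarrow> 'a set \<Rightarrow> 'a set"
  where "reflect u E = {u - v |v. v \<in> E}"

text \<open>
  The conditions ``the limit of the ratio as \<open>r\<close> decreases to 0 is at most 1'' are read with the upper
  limit. A limit of the ratio for an individual \<open>v\<close> need not exist, even if the limit of the ratio
  for the supremum does. Where the limit exists, the reading agrees with the literal one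
  (\<open>Limsup_le_1_iff_lim_le_1\<close> below).
\<close>

definition weak_mode :: "('k::real_normed_field \<Rightarrow> 'a::topological_ab_group_add \<Rightarrow> 'a) \<Rightarrow> 'a set \<Rightarrow>
    'a measure \<Rightarrow> 'a set \<Rightarrow> 'a \<Rightarrow> bool"
  where "weak_mode smul K \<mu> E u \<longleftrightarrow> u \<in> msupp \<mu> \<and>
    (\<forall>v\<in>E. Limsup (at_right 0) (\<lambda>r. Kmass smul K \<mu> (u - v) r / Kmass smul K \<mu> u r) \<le> 1)"

definition strong_mode :: "('k::real_normed_field \<Rightarrow> 'a::topological_ab_group_add \<Rightarrow> 'a) \<Rightarrow> 'a set \<Rightarrow>
    'a measure \<Rightarrow> 'a set \<Rightarrow> 'a \<Rightarrow> bool"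
  where "strong_mode smul K \<mu> E u \<longleftrightarrow> u \<in> msupp \<mu> \<and>
    Limsup (at_right 0) (\<lambda>r. (SUP z\<in>reflect u E. Kmass smul K \<mu> z r) / Kmass smul K \<mu> u r) \<le> 1"

lemma Limsup_le_1_iff_lim_le_1:
  fixes g :: "real \<Rightarrow> ennreal"
  assumes "(g \<longlongrightarrow> L) (at_right 0)"
  shows "Limsup (at_right 0) g \<le> 1 \<longleftrightarrow> L \<le> 1"
  using lim_imp_Limsup[OF _ assms] by simp

definition uniformity_condition :: "('k::real_normed_field \<Rightarrow> 'a::topological_ab_group_add \<Rightarrow> 'a) \<Rightarrow>
    'a set \<Rightarrow> 'a measure \<Rightarrow> 'a \<Rightarrow> 'a set \<Rightarrow> bool"
  where "uniformity_condition smul K \<mu> u E \<longleftrightarrow>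
    (\<exists>v\<in>E. \<exists>R\<in>{0<..<1}. \<forall>r\<in>{0<..<R}.
      Kmass smul K \<mu> (u - v) r = (SUP z\<in>reflect u E. Kmass smul K \<mu> z r))"

end

theory Submission
  imports Defs
begin

text \<open>
  Each translate \<open>u - v\<close> with \<open>v\<close> in \<open>E\<close> is one of the centres over which the strong condition takes its
  supremum, so the ratio in the weak condition is bounded pointwise in \<open>r\<close> by the ratio in the strong
  one, and upper limits are monotone (\<open>strong_mode_imp_weak_mode\<close>).

  Conversely, the weak condition bounds the ratios one \<open>v\<close> at a time, and in general the centre that
  nearly attains the supremum moves with \<open>r\<close>. Uniformity says that for all small \<open>r\<close> one fixed
  \<open>v\<close> attains it. The strong ratio then agrees near 0 with the weak ratio of this single
  \<open>v\<close>, and the two have the same upper limit (\<open>weak_mode_imp_strong_mode\<close>).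
\<close>

lemma strong_mode_imp_weak_mode:
  assumes "strong_mode smul K \<mu> E u"
  shows "weak_mode smul K \<mu> E u"
  unfolding weak_mode_def
proof (intro conjI ballI)
  show "u \<in> msupp \<mu>"
    using assms by (simp add: strong_mode_def)
next
  fix v assume "v \<in> E"
  then have "u - v \<in> reflect u E"
    by (auto simp: reflect_def)
  then have "Kmass smul K \<mu> (u - v) r / Kmass smul K \<mu> u r
      \<le> (SUP z\<in>reflect u E. Kmass smul K \<mu> z r) / Kmass smul K \<mu> u r" for r
    by (intro divide_right_mono_ennreal SUP_upper)
  then have "Limsup (at_right 0) (\<lambda>r. Kmass smul K \<mu> (u - v) r / Kmass smul K \<mu> u r)
      \<le> Limsup (at_right 0) (\<lambda>r. (SUP z\<in>reflect u E. Kmass smul K \<mu> z r) / Kmass smul K \<mu> u r)"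
    by (intro Limsup_mono always_eventually allI)
  also have "\<dots> \<le> 1"
    using assms by (simp add: strong_mode_def)
  finally show "Limsup (at_right 0) (\<lambda>r. Kmass smul K \<mu> (u - v) r / Kmass smul K \<mu> u r) \<le> 1" .
qed

lemma weak_mode_imp_strong_mode:
  assumes unif: "uniformity_condition smul K \<mu> u E"
    and weak: "weak_mode smul K \<mu> E u"
  shows "strong_mode smul K \<mu> E u"
proof -
  obtain v R where "v \<in> E" and "R \<in> {0<..<1}" and attained: "\<forall>r\<in>{0<..<R}.
      Kmass smul K \<mu> (u - v) r = (SUP z\<in>reflect u E. Kmass smul K \<mu> z r)"
    using unif unfolding uniformity_condition_def by blast
  have "\<forall>\<^sub>F r in at_right 0. r \<in> {0<..<R}"
    using \<open>R \<in> {0<..<1}\<close> by (intro eventually_at_right_real) simp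
  then have "\<forall>\<^sub>F r in at_right 0.
      (SUP z\<in>reflect u E. Kmass smul K \<mu> z r) / Kmass smul K \<mu> u r
      = Kmass smul K \<mu> (u - v) r / Kmass smul K \<mu> u r"
    by eventually_elim (use attained in simp)
  then have "Limsup (at_right 0) (\<lambda>r. (SUP z\<in>reflect u E. Kmass smul K \<mu> z r) / Kmass smul K \<mu> u r)
      = Limsup (at_right 0) (\<lambda>r. Kmass smul K \<mu> (u - v) r / Kmass smul K \<mu> u r)"
    by (rule Limsup_eq)
  with weak \<open>v \<in> E\<close> show ?thesis
    by (simp add: weak_mode_def strong_mode_def)
qed

theorem theorem2p6:
  fixes smul :: "'k::real_normed_field \<Rightarrow>
      'a::{topological_ab_group_add, first_countable_topology, t2_space} \<Rightarrow> 'a"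
    and \<mu> :: "'a measure" and K E :: "'a set" and u :: 'a
  assumes "topological_vector_space smul"
    and "sets \<mu> = sets borel"
    and "emeasure \<mu> (space \<mu>) \<noteq> 0"
    and "\<And>B. B \<in> sets borel \<Longrightarrow> tvs_bounded smul B \<Longrightarrow> emeasure \<mu> B < \<infinity>"
    and "open K" and "0 \<in> K" and "tvs_bounded smul K"
    and "E \<noteq> {}"
    and "uniformity_condition smul K \<mu> u E"
  shows "weak_mode smul K \<mu> E u \<longleftrightarrow> strong_mode smul K \<mu> E u"
  using weak_mode_imp_strong_mode[OF assms(9)] strong_mode_imp_weak_mode by blast

end
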